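(* Let $\alpha\in(0,1)$ be irrational, $d\ge1$, $\beta_1,\dots,\beta_d\in[0,1)$, $\psi(x)=\{x\}-\frac12$, and let $\Psi_{d+1}:\mathbb T\to\mathbb R^{d+1}$, $\Psi_{d+1}(x)=(\psi(x),\psi(x+\beta_1),\dots,\psi(x+\beta_d))$, be regarded as a cocycle over $Tx=x+\alpha$. Then the group of essential values $\mathcal E(\Psi_{d+1})$ includes the diagonal subgroup $\Delta_{d+1}=\{(t,\dots,t):t\in\mathbb R\}$ of $\mathbb R^{d+1}$.
   Context: $\mathbb T=[0,1)$ is the additive circle (addition mod $1$) with Lebesgue measure $\mu$; $\{x\}$ is the fractional part. For a cocycle, i.e. a measurable $\Phi:\mathbb T\to\mathbb R^m$, let $\Phi_n(x)=\sum_{k=0}^{n-1}\Phi(T^kx)$ for $n\ge1$, extended to $n\in\mathbb Z$ by $\Phi_{n+k}(x)=\Phi_n(x)+\Phi_k(T^nx)$. An element $g\in\mathbb R^m$ is an essential value of $\Phi$ (over $T$) if for every open neighborhood $U$ of $g$ and every Borel set $A$ with $\mu(A)>0$ there is $N\in\mathbb Z$ with $\mu(A\cap T^{-N}A\cap\{x:\Phi_N(x)\in U\})>0$. The set $\mathcal E(\Phi)\subset\mathbb R^m$ of essential values is a closed subgroup of $\mathbb R^m$. *)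

theory Defs
  imports "HOL-Analysis.Analysis"
begin

definition circle :: "real measure" where
  "circle = restrict_space lborel {0..<1}"

definition rotation :: "real \<Rightarrow> real \<Rightarrow> real" where
  "rotation \<alpha> x = frac (x + \<alpha>)"

text \<open>Integer iterates of a map \<open>T\<close> that is a bijection of \<open>space M\<close>; they are only
  meaningful at points of \<open>space M\<close>.\<close>

definition iterate :: "'a measure \<Rightarrow> ('a \<Rightarrow> 'a) \<Rightarrow> int \<Rightarrow> 'a \<Rightarrow> 'a" where
  "iterate M T n =
     (if n \<ge> 0 then T ^^ nat n else inv_into (space M) T ^^ nat (- n))"

text \<open>For \<open>n < 0\<close> the value is forced by the cocycle identity, which gives
  \<open>0 = \<Phi>\<^sub>n(x) + \<Phi>\<^sub>-\<^sub>n(T\<^sup>n x)\<close>; the identity itself is \<open>cocycle_sum_add\<close> below.\<close>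

definition cocycle_sum ::
  "'a measure \<Rightarrow> ('a \<Rightarrow> 'a) \<Rightarrow> ('a \<Rightarrow> real ^ 'm) \<Rightarrow> int \<Rightarrow> 'a \<Rightarrow> real ^ 'm" where
  "cocycle_sum M T \<Phi> n x =
     (if n \<ge> 0 then (\<Sum>k<nat n. \<Phi> ((T ^^ k) x))
      else - (\<Sum>k<nat (- n). \<Phi> ((T ^^ k) (iterate M T n x))))"

definition essential_value ::
  "'a measure \<Rightarrow> ('a \<Rightarrow> 'a) \<Rightarrow> ('a \<Rightarrow> real ^ 'm) \<Rightarrow> real ^ 'm \<Rightarrow> bool" where
  "essential_value M T \<Phi> g \<longleftrightarrow>
     (\<forall>U A. open U \<and> g \<in> U \<and> A \<in> sets M \<and> emeasure M A > 0 \<longrightarrow>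
        (\<exists>N::int. emeasure M
            (A \<inter> {x \<in> space M. iterate M T N x \<in> A}
               \<inter> {x \<in> space M. cocycle_sum M T \<Phi> N x \<in> U}) > 0))"

definition essential_values ::
  "'a measure \<Rightarrow> ('a \<Rightarrow> 'a) \<Rightarrow> ('a \<Rightarrow> real ^ 'm) \<Rightarrow> (real ^ 'm) set" where
  "essential_values M T \<Phi> = {g. essential_value M T \<Phi> g}"

definition diagonal_subgroup :: "(real ^ 'm) set" where
  "diagonal_subgroup = range (\<lambda>t. \<chi> i. t)"

definition psi :: "real \<Rightarrow> real" where
  "psi x = frac x - 1 / 2"

text \<open>The \<open>d + 1\<close> coordinates are indexed by \<open>'d option\<close> with \<open>CARD('d) = d\<close>: \<open>None\<close> is the
  leading, unshifted coordinate and \<open>Some j\<close> the one shifted by \<open>\<beta>\<^sub>j\<close>.\<close>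

definition Psi :: "('d::finite \<Rightarrow> real) \<Rightarrow> real \<Rightarrow> real ^ 'd option" where
  "Psi \<beta> x = (\<chi> i. case i of None \<Rightarrow> psi x | Some j \<Rightarrow> psi (x + \<beta> j))"

lemma space_circle [simp]: "space circle = {0..<1}"
  by (simp add: circle_def space_restrict_space)

lemma Psi_measurable: "Psi \<beta> \<in> borel_measurable circle"
proof -
  have [measurable]: "psi \<in> borel_measurable borel"
    unfolding psi_def frac_def by measurable
  have "(\<lambda>x. Psi \<beta> x $ i) \<in> borel_measurable borel" for i
    by (cases i) (simp_all add: Psi_def)
  then have "Psi \<beta> \<in> borel_measurable borel"
    by (subst borel_measurable_euclidean_space)
      (auto simp: Basis_vec_def cart_eq_inner_axis[symmetric])
  then show ?thesis
    unfolding circle_def by (simp add: measurable_restrict_space1)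
qed

lemma iterate_Suc:
  assumes "bij_betw T (space M) (space M)" "x \<in> space M"
  shows "iterate M T (n + 1) x = T (iterate M T n x)"
proof (cases "n \<ge> 0")
  case True
  then show ?thesis by (simp add: iterate_def nat_add_distrib)
next
  case False
  define S where "S = inv_into (space M) T"
  have S: "S y \<in> space M" "T (S y) = y" if "y \<in> space M" for y
    using assms(1) that unfolding S_def
    by (auto simp: bij_betw_def inv_into_into f_inv_into_f)
  have in_sp: "(S ^^ k) x \<in> space M" for k
    by (induction k) (use assms(2) S in auto)
  have "nat (- n) = Suc (nat (- (n + 1)))" using False by simp
  then have "T (iterate M T n x) = (S ^^ nat (- (n + 1))) x"
    using False S(2)[OF in_sp] by (simp add: iterate_def S_def)
  also have "\<dots> = iterate M T (n + 1) x"
    using False by (cases "n = -1") (auto simp: iterate_def S_def)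
  finally show ?thesis by simp
qed

lemma iterate_in_space:
  assumes "bij_betw T (space M) (space M)" "x \<in> space M"
  shows "iterate M T n x \<in> space M"
proof -
  have "(T ^^ k) x \<in> space M" for k
    by (induction k) (use assms in \<open>auto simp: bij_betw_def\<close>)
  moreover have "(inv_into (space M) T ^^ k) x \<in> space M" for k
    by (induction k) (use assms in \<open>auto simp: bij_betw_def inv_into_into\<close>)
  ultimately show ?thesis by (simp add: iterate_def)
qed

lemma iterate_add:
  assumes "bij_betw T (space M) (space M)" "x \<in> space M"
  shows "iterate M T (n + k) x = iterate M T k (iterate M T n x)"
proof (induction k rule: int_induct[where k = 0])
  case base
  then show ?case by (simp add: iterate_def[of _ _ 0])
next
  case (step1 i)
  then show ?case
    using iterate_Suc[OF assms, of "n + i"] iterate_Suc[OF assms(1) iterate_in_space[OF assms], of i n]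
    by (simp add: add.assoc)
next
  case (step2 i)
  let ?y = "iterate M T n x"
  have "T (iterate M T (n + (i - 1)) x) = T (iterate M T (i - 1) ?y)"
    using step2 iterate_Suc[OF assms, of "n + (i - 1)"]
      iterate_Suc[OF assms(1) iterate_in_space[OF assms], of "i - 1" n]
    by simp
  then show ?case
    using assms iterate_in_space[OF assms(1)] unfolding bij_betw_def
    by (meson inj_onD assms(1) iterate_in_space)
qed

lemma cocycle_sum_Suc:
  assumes "bij_betw T (space M) (space M)" "x \<in> space M"
  shows "cocycle_sum M T \<Phi> (n + 1) x = cocycle_sum M T \<Phi> n x + \<Phi> (iterate M T n x)"
proof (cases "n \<ge> 0")
  case True
  then show ?thesis by (simp add: cocycle_sum_def iterate_def nat_add_distrib)
next
  case False
  define m where "m = nat (- (n + 1))"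
  have m: "nat (- n) = Suc m" using False by (simp add: m_def)
  have "(\<Sum>k<Suc m. \<Phi> ((T ^^ k) (iterate M T n x))) =
      \<Phi> (iterate M T n x) + (\<Sum>k<m. \<Phi> ((T ^^ k) (iterate M T (n + 1) x)))"
    by (subst sum.lessThan_Suc_shift)
      (simp add: iterate_Suc[OF assms] funpow_Suc_right del: funpow.simps)
  then show ?thesis
    using False m by (cases "n = -1") (auto simp: cocycle_sum_def m_def)
qed

lemma cocycle_sum_add:
  assumes "bij_betw T (space M) (space M)" "x \<in> space M"
  shows "cocycle_sum M T \<Phi> (n + k) x =
    cocycle_sum M T \<Phi> n x + cocycle_sum M T \<Phi> k (iterate M T n x)"
proof (induction k rule: int_induct[where k = 0])
  case base
  then show ?case by (simp add: cocycle_sum_def[of _ _ _ 0])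
next
  case (step1 i)
  then show ?case
    using cocycle_sum_Suc[OF assms, of \<Phi> "n + i"] iterate_add[OF assms, of n i]
      cocycle_sum_Suc[OF assms(1) iterate_in_space[OF assms], of \<Phi> i n]
    by (simp add: add.assoc)
next
  case (step2 i)
  then show ?case
    using cocycle_sum_Suc[OF assms, of \<Phi> "n + (i - 1)"] iterate_add[OF assms, of n "i - 1"]
      cocycle_sum_Suc[OF assms(1) iterate_in_space[OF assms], of \<Phi> "i - 1" n]
    by (simp add: algebra_simps)
qed

lemma frac_add_frac: "frac (frac a + b) = frac (a + b :: real)"
proof -
  have "frac a + b = (a + b) - of_int (floor a)" by (simp add: frac_def)
  moreover have "frac ((a + b) - of_int (floor a)) = frac (a + b)"
    unfolding frac_def floor_diff_of_int by simp
  ultimately show ?thesis by (simp only:)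
qed

lemma bij_betw_rotation: "bij_betw (rotation \<alpha>) (space circle) (space circle)"
proof (rule bij_betw_byWitness[where f' = "rotation (- \<alpha>)"])
  show "\<forall>x\<in>space circle. rotation (- \<alpha>) (rotation \<alpha> x) = x"
    and "\<forall>x\<in>space circle. rotation \<alpha> (rotation (- \<alpha>) x) = x"
    unfolding rotation_def frac_add_frac by (auto simp: frac_eq)
qed (auto simp: rotation_def frac_lt_1)

lemma iterate_rotation:
  assumes "x \<in> space circle"
  shows "iterate circle (rotation \<alpha>) n x = frac (x + of_int n * \<alpha>)"
proof (induction n rule: int_induct[where k = 0])
  case base
  then show ?case using assms by (simp add: iterate_def frac_eq)
next
  case (step1 i)
  have "iterate circle (rotation \<alpha>) (i + 1) x = frac (frac (x + of_int i * \<alpha>) + \<alpha>)"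
    by (simp only: iterate_Suc[OF bij_betw_rotation assms] step1 rotation_def[of \<alpha> "frac _"])
  then show ?case
    unfolding frac_add_frac by (simp add: algebra_simps)
next
  case (step2 i)
  have "rotation \<alpha> (iterate circle (rotation \<alpha>) (i - 1) x) = frac (x + of_int i * \<alpha>)"
    using step2 iterate_Suc[OF bij_betw_rotation assms, of \<alpha> "i - 1"] by simp
  also have "\<dots> = rotation \<alpha> (frac (x + of_int (i - 1) * \<alpha>))"
    unfolding rotation_def frac_add_frac by (simp add: algebra_simps)
  finally show ?case
    using bij_betw_rotation[of \<alpha>] iterate_in_space[OF bij_betw_rotation assms, of \<alpha> "i - 1"]
    by (auto simp: bij_betw_def frac_lt_1 dest: inj_onD)
qed

end

theory Submission
  imports Defs
begin

text \<open>Take coprime \<open>p\<close>, \<open>q\<close> with \<open>\<bar>\<alpha> - p/q\<bar> < 1/q\<^sup>2\<close> and \<open>q\<close> large. The sum \<open>\<Psi>\<^sub>q\<close> is bounded independently of \<open>q\<close>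
  (Denjoy--Koksma). It has only \<open>(d + 1)q\<close> jumps, and away from them all its coordinates grow with the
  same slope \<open>q\<close>, so at most points \<open>x\<close> it travels along the diagonal by a fixed amount \<open>c\<close> as
  \<open>x\<close> moves by \<open>c/q\<close>. By compactness there is a \<open>g\<close> such that, for infinitely many such \<open>q\<close>, \<open>\<Psi>\<^sub>q\<close> visits each neighbourhood
  of each point of the segment from \<open>g\<close> to \<open>g + (c, \<dots>, c)\<close> with probability bounded below.
  Since the times \<open>q\<close> are rigid (\<open>q\<alpha> \<rightarrow> 0\<close> modulo 1), \<open>\<Psi>\<^sub>q\<close> is asymptotically invariant under the
  rotation, and ergodicity spreads these visits over every set of positive measure, which makes
  the whole segment consist of essential values. Differences of essential values are essential
  values, and so the diagonal is reached.\<close>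

section \<open>Rotations of the circle\<close>

interpretation circle: finite_measure circle
  by standard (simp add: circle_def space_restrict_space emeasure_restrict_space)

lemma measure_space_circle: "measure circle {0..<1} = 1"
  by (simp add: circle_def measure_restrict_space)

lemma measure_circle_Un_le:
  "A \<in> sets circle \<Longrightarrow> B \<in> sets circle \<Longrightarrow>
    measure circle (A \<union> B) \<le> measure circle A + measure circle B"
  by (intro measure_subadditive) simp_all

lemma sets_circle_iff: "A \<in> sets circle \<longleftrightarrow> A \<in> sets borel \<and> A \<subseteq> {0..<1}"
  by (auto simp: circle_def sets_restrict_space_iff)

lemma emeasure_circle: "A \<in> sets circle \<Longrightarrow> emeasure circle A = emeasure lborel A"
  by (simp add: circle_def emeasure_restrict_space sets_restrict_space_iff)

lemma rotation_in_circle [simp]: "0 \<le> rotation t x" "rotation t x < 1"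
  by (simp_all add: rotation_def frac_lt_1)

lemma rotation_rotation: "rotation s (rotation t x) = rotation (t + s) x"
  by (simp add: rotation_def frac_add_frac add.assoc)

lemma rotation_0: "x \<in> {0..<1} \<Longrightarrow> rotation 0 x = x"
  by (simp add: rotation_def frac_eq)

lemma rotation_plus_int: "rotation (t + of_int k) x = rotation t x"
  by (simp add: rotation_def frac_def add.assoc[symmetric])

lemma rotation_eq_plus: "0 \<le> x + t \<Longrightarrow> x + t < 1 \<Longrightarrow> rotation t x = x + t"
  by (simp add: rotation_def frac_eq)

lemma borel_measurable_frac [measurable]: "(frac :: real \<Rightarrow> real) \<in> borel_measurable borel"
  unfolding frac_def by measurable

lemma rotation_measurable [measurable]: "rotation t \<in> circle \<rightarrow>\<^sub>M circle"
  unfolding circle_def rotation_def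
  by (intro measurable_restrict_space2 measurable_restrict_space1)
    (auto simp: space_restrict_space frac_lt_1)

lemma emeasure_lborel_translate:
  fixes c :: real
  assumes "A \<in> sets borel"
  shows "emeasure lborel {x. x + c \<in> A} = emeasure lborel A"
proof -
  have "emeasure lborel A = emeasure (distr lborel borel ((+) c)) A"
    by (metis lborel_distr_plus)
  also have "\<dots> = emeasure lborel {x. x + c \<in> A}"
    using assms by (simp add: emeasure_distr vimage_def add.commute)
  finally show ?thesis by simp
qed

text \<open>A rotation is a piecewise translation: by \<open>c\<close> where \<open>x + c\<close>
  stays below 1, by \<open>c - 1\<close> where it wraps around. The first kind of point lands at or
  above \<open>c\<close>, the second below \<open>c\<close>, so cutting \<open>A\<close> at
  \<open>c\<close> reduces the claim to translation invariance of Lebesgue measure.\<close>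

lemma emeasure_rotation_vimage:
  assumes "A \<in> sets circle"
  shows "emeasure circle {x \<in> {0..<1}. rotation t x \<in> A} = emeasure circle A"
proof -
  define c where "c = frac t"
  have c: "0 \<le> c" "c < 1" by (auto simp: c_def frac_lt_1)
  have A: "A \<in> sets borel" "A \<subseteq> {0..<1}" using assms by (auto simp: sets_circle_iff)
  have rot: "rotation t x = (if x + c < 1 then x + c else x + (c - 1))" if "x \<in> {0..<1}" for x
  proof -
    have "rotation t x = frac (x + c)"
      unfolding rotation_def c_def by (metis add.commute frac_add_frac)
    also have "\<dots> = (if x + c < 1 then x + c else x + (c - 1))"
      using that c by (auto simp: frac_unique_iff)
    finally show ?thesis .
  qed
  let ?B = "A \<inter> {c..}" and ?C = "A \<inter> {..<c}"
  have [measurable]: "A \<in> sets borel" by fact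
  have "{x \<in> {0..<1}. rotation t x \<in> A} = {x. x + c \<in> ?B} \<union> {x. x + (c - 1) \<in> ?C}"
    using A(2) c by (auto simp: rot split: if_splits)
  moreover have "{x \<in> {0..<1}. rotation t x \<in> A} \<in> sets circle"
    using measurable_sets[OF rotation_measurable assms, of t]
    by (simp add: vimage_def Int_def conj_commute)
  moreover have "emeasure lborel ({x. x + c \<in> ?B} \<union> {x. x + (c - 1) \<in> ?C}) =
      emeasure lborel {x. x + c \<in> ?B} + emeasure lborel {x. x + (c - 1) \<in> ?C}"
  proof (rule plus_emeasure[symmetric])
    show "{x. x + c \<in> ?B} \<inter> {x. x + (c - 1) \<in> ?C} = {}"
    proof (rule equals0I)
      fix x assume "x \<in> {x. x + c \<in> ?B} \<inter> {x. x + (c - 1) \<in> ?C}"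
      then have "x + c \<in> {0..<1}" "x + (c - 1) \<in> {0..<1}" using A(2) by blast+
      then show False by simp
    qed
  qed measurable
  ultimately have "emeasure circle {x \<in> {0..<1}. rotation t x \<in> A} =
      emeasure lborel {x. x + c \<in> ?B} + emeasure lborel {x. x + (c - 1) \<in> ?C}"
    by (simp only: emeasure_circle)
  also have "\<dots> = emeasure lborel ?B + emeasure lborel ?C"
    by (intro arg_cong2[where f = "(+)"] emeasure_lborel_translate) measurable
  also have "\<dots> = emeasure lborel (?B \<union> ?C)"
    by (rule plus_emeasure) auto
  also have "?B \<union> ?C = A" by auto
  finally show ?thesis using assms by (simp add: emeasure_circle)
qed

lemma measure_rotation_vimage:
  "A \<in> sets circle \<Longrightarrow> measure circle {x \<in> {0..<1}. rotation t x \<in> A} = measure circle A"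
  unfolding measure_def by (simp only: emeasure_rotation_vimage)

lemma rotation_vimage_sets [measurable]:
  assumes "A \<in> sets circle"
  shows "{x \<in> {0..<1}. rotation t x \<in> A} \<in> sets circle"
  using measurable_sets[OF rotation_measurable assms, of t]
  by (simp add: vimage_def Int_def conj_commute)

lemma rotation_vimage_compl_sets:
  assumes "A \<in> sets circle" "B \<in> sets circle"
  shows "{x \<in> A. rotation t x \<notin> B} \<in> sets circle"
proof -
  have "{x \<in> A. rotation t x \<notin> B} = A - {x \<in> {0..<1}. rotation t x \<in> B}"
    using assms by (auto simp: sets_circle_iff)
  then show ?thesis using assms by (simp only: sets.Diff rotation_vimage_sets)
qed

lemma rotation_vimage_Int_sets:
  assumes "A \<in> sets circle" "B \<in> sets circle"
  shows "{x \<in> A. rotation t x \<in> B} \<in> sets circle"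
proof -
  have "{x \<in> A. rotation t x \<in> B} = A \<inter> {x \<in> {0..<1}. rotation t x \<in> B}"
    using assms by (auto simp: sets_circle_iff)
  then show ?thesis using assms by (simp only: sets.Int rotation_vimage_sets)
qed

section \<open>Small rotations move sets only slightly\<close>

text \<open>By regularity \<open>A\<close> lies between a compact \<open>K\<close> and an open
  \<open>V\<close> that differ from it by little measure, and a small translation cannot carry
  \<open>K\<close> out of \<open>V\<close>. The filter is \<open>nhds 0\<close> rather than
  \<open>at 0\<close> so that the limit composes with every null sequence.\<close>

lemma tendsto_measure_rotation_leaves:
  assumes "A \<in> sets circle"
  shows "((\<lambda>\<delta>. measure circle {x \<in> A. rotation \<delta> x \<notin> A}) \<longlongrightarrow> 0) (nhds 0)"
proof (rule tendstoI)
  fix e :: real assume "e > 0"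
  have A: "A \<in> sets borel" "A \<subseteq> {0..<1}" using assms by (auto simp: sets_circle_iff)
  obtain V where V: "open V" "A \<subseteq> V" "emeasure lborel (V - A) < ennreal (e / 2)"
    using outer_regular_lborel[OF A(1), of "e / 2"] \<open>e > 0\<close> by auto
  obtain K where K: "closed K" "K \<subseteq> A" "emeasure lebesgue (A - K) < ennreal (e / 2)"
    using sets_lebesgue_inner_closed[of A "e / 2"] A \<open>e > 0\<close>
    by (metis half_gt_zero sets_completionI_sets sets_lborel)
  have "bounded K" using K A by (meson bounded_subset bounded_subset[OF bounded_closed_interval] atLeastLessThan_subseteq_atLeastAtMost_iff order.refl)
  then have "compact K" using K by (simp add: compact_eq_bounded_closed)
  then obtain r where r: "r > 0" "(\<Union>x\<in>K. ball x r) \<subseteq> V"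
    using compact_subset_open_imp_ball_epsilon_subset[of K V] V K by blast
  have [measurable]: "A \<in> sets borel" "V \<in> sets borel" "K \<in> sets borel"
    using A V K by auto
  have "measure circle {x \<in> A. rotation \<delta> x \<notin> A} < e" if "\<bar>\<delta>\<bar> < r" for \<delta>
  proof -
    have "emeasure circle {x \<in> A. rotation \<delta> x \<notin> A} =
        emeasure lborel {x \<in> A. rotation \<delta> x \<notin> A}"
      by (intro emeasure_circle rotation_vimage_compl_sets assms)
    also have "\<dots> \<le> emeasure lborel ((A - K) \<union> {x. x + \<delta> \<in> V - A})"
    proof (rule emeasure_mono)
      \<comment> \<open>If \<open>x + \<delta>\<close> were in \<open>A\<close>, it would lie in
        \<open>[0, 1)\<close> and so equal \<open>rotation \<delta> x\<close>; hence wrapping around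
        needs no case of its own.\<close>
      show "{x \<in> A. rotation \<delta> x \<notin> A} \<subseteq> (A - K) \<union> {x. x + \<delta> \<in> V - A}"
      proof
        fix x assume "x \<in> {x \<in> A. rotation \<delta> x \<notin> A}"
        then have x: "x \<in> A" "rotation \<delta> x \<notin> A" by auto
        have "x + \<delta> \<in> V" if "x \<in> K"
        proof -
          have "x + \<delta> \<in> ball x r" using \<open>\<bar>\<delta>\<bar> < r\<close> by (simp add: dist_real_def)
          then show ?thesis using r(2) that by blast
        qed
        moreover have "x + \<delta> \<notin> A"
          using x(2) A(2) rotation_eq_plus[of x \<delta>] by auto
        ultimately show "x \<in> (A - K) \<union> {x. x + \<delta> \<in> V - A}" using x(1) by blast
      qed
    qed measurable
    also have "\<dots> \<le> emeasure lborel (A - K) + emeasure lborel {x. x + \<delta> \<in> V - A}"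
      by (rule emeasure_subadditive) measurable
    also have "\<dots> = emeasure lborel (A - K) + emeasure lborel (V - A)"
      by (simp add: emeasure_lborel_translate del: Diff_iff)
    also have "\<dots> < ennreal (e / 2) + ennreal (e / 2)"
      using K(3) V(3) by (intro add_strict_mono) (simp_all add: emeasure_completion)
    also have "\<dots> = ennreal e" using \<open>e > 0\<close> by (simp flip: ennreal_plus)
    finally show ?thesis
      by (simp add: circle.emeasure_eq_measure ennreal_less_iff)
  qed
  then show "\<forall>\<^sub>F \<delta> in nhds 0. dist (measure circle {x \<in> A. rotation \<delta> x \<notin> A}) 0 < e"
    unfolding eventually_nhds_metric using r(1) by (auto simp: dist_real_def)
qed

section \<open>Ergodicity of irrational rotations\<close>

text \<open>By Fubini, the integral over \<open>t\<close> of the measures in question is the product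
  of the measures of \<open>A\<close> and \<open>B\<close>, which is positive, so they cannot vanish
  for all \<open>t\<close>.\<close>

lemma exists_rotation_meets:
  assumes "A \<in> sets circle" "B \<in> sets circle" "emeasure circle A > 0" "emeasure circle B > 0"
  shows "\<exists>t. emeasure circle {x \<in> A. rotation t x \<in> B} > 0"
proof (rule ccontr)
  assume "\<not> ?thesis"
  then have z: "emeasure circle {x \<in> A. rotation t x \<in> B} = 0" for t
    by (auto simp: zero_less_iff_neq_zero)
  interpret P: pair_sigma_finite circle circle ..
  have [measurable]: "A \<in> sets circle" "B \<in> sets circle" by fact+
  have pm [measurable]: "(\<lambda>(x, t). rotation t x) \<in> circle \<Otimes>\<^sub>M circle \<rightarrow>\<^sub>M circle"
  proof -
    have id: "(\<lambda>x. x) \<in> circle \<rightarrow>\<^sub>M borel"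
      unfolding circle_def by (simp add: measurable_restrict_space1)
    have [measurable]: "fst \<in> circle \<Otimes>\<^sub>M circle \<rightarrow>\<^sub>M borel" "snd \<in> circle \<Otimes>\<^sub>M circle \<rightarrow>\<^sub>M borel"
      using measurable_compose[OF measurable_fst id] measurable_compose[OF measurable_snd id]
      by auto
    have "(\<lambda>p. rotation (snd p) (fst p)) \<in> circle \<Otimes>\<^sub>M circle \<rightarrow>\<^sub>M borel"
      unfolding rotation_def by measurable
    then show ?thesis
      by (subst circle_def)
        (auto intro!: measurable_restrict_space2 simp: case_prod_beta)
  qed
  have "emeasure circle A * emeasure circle B =
      (\<integral>\<^sup>+x. indicator A x * emeasure circle B \<partial>circle)"
    by (simp add: nn_integral_multc)
  also have "\<dots> = (\<integral>\<^sup>+x. indicator A x * (\<integral>\<^sup>+t. indicator B (rotation t x) \<partial>circle) \<partial>circle)"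
  proof (rule nn_integral_cong)
    fix x :: real
    \<comment> \<open>\<open>rotation t x\<close> is symmetric in \<open>t\<close> and
      \<open>x\<close>, so integrating over the angle measures a rotated copy of
      \<open>B\<close>.\<close>
    have "(\<integral>\<^sup>+t. indicator B (rotation t x) \<partial>circle) =
        (\<integral>\<^sup>+t. indicator {t \<in> {0..<1}. rotation x t \<in> B} t \<partial>circle)"
      by (intro nn_integral_cong) (auto simp: rotation_def add.commute split: split_indicator)
    also have "\<dots> = emeasure circle B"
      by (simp only: nn_integral_indicator rotation_vimage_sets emeasure_rotation_vimage assms)
    finally show "indicator A x * emeasure circle B =
        indicator A x * (\<integral>\<^sup>+t. indicator B (rotation t x) \<partial>circle)" by simp
  qed
  also have "\<dots> = (\<integral>\<^sup>+x. (\<integral>\<^sup>+t. indicator A x * indicator B (rotation t x) \<partial>circle) \<partial>circle)"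
  proof (rule nn_integral_cong)
    fix x assume "x \<in> space circle"
    then have "(\<lambda>t. rotation t x) \<in> circle \<rightarrow>\<^sub>M circle"
      using measurable_Pair2[OF pm, of x] by simp
    then show "indicator A x * (\<integral>\<^sup>+t. indicator B (rotation t x) \<partial>circle) =
        (\<integral>\<^sup>+t. indicator A x * indicator B (rotation t x) \<partial>circle)"
      by (intro nn_integral_cmult[symmetric] measurable_compose[OF _ borel_measurable_indicator])
        auto
  qed
  also have "\<dots> = (\<integral>\<^sup>+t. (\<integral>\<^sup>+x. indicator A x * indicator B (rotation t x) \<partial>circle) \<partial>circle)"
    by (rule P.Fubini'[symmetric]) (use pm in measurable)
  also have "\<dots> = (\<integral>\<^sup>+t. emeasure circle {x \<in> A. rotation t x \<in> B} \<partial>circle)"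
  proof (rule nn_integral_cong)
    fix t
    have s: "{x \<in> A. rotation t x \<in> B} \<in> sets circle"
      by (intro rotation_vimage_Int_sets assms)
    have "(\<integral>\<^sup>+x. indicator A x * indicator B (rotation t x) \<partial>circle) =
       (\<integral>\<^sup>+x. indicator {x \<in> A. rotation t x \<in> B} x \<partial>circle)"
      by (intro nn_integral_cong) (auto split: split_indicator)
    then show "(\<integral>\<^sup>+x. indicator A x * indicator B (rotation t x) \<partial>circle) =
       emeasure circle {x \<in> A. rotation t x \<in> B}" using s by simp
  qed
  also have "\<dots> = 0" by (simp add: z)
  finally show False using assms by auto
qed

text \<open>The multiples of \<open>\<alpha>\<close> are dense modulo 1, so some
  \<open>k * \<alpha>\<close> differs from an angle \<open>t\<close> of the previous lemma by a
  small \<open>\<delta>\<close> modulo 1. Part of \<open>D\<close> of positive measure stays in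
  \<open>D\<close> under the rotation by \<open>\<delta>\<close>, and the rotation by
  \<open>t\<close> then takes it into \<open>B\<close>.\<close>

lemma exists_orbit_meets:
  assumes "\<alpha> \<notin> \<rat>" "A \<in> sets circle" "B \<in> sets circle"
    and "emeasure circle A > 0" "emeasure circle B > 0"
  shows "\<exists>n::int. emeasure circle {x \<in> A. rotation (of_int n * \<alpha>) x \<in> B} > 0"
proof -
  obtain t where t: "emeasure circle {x \<in> A. rotation t x \<in> B} > 0"
    using exists_rotation_meets assms by blast
  define D where "D = {x \<in> A. rotation t x \<in> B}"
  have D: "D \<in> sets circle"
    unfolding D_def by (intro rotation_vimage_Int_sets assms)
  have pos: "measure circle D > 0"
    using t by (simp add: D_def circle.emeasure_eq_measure)
  have "\<forall>\<^sub>F \<delta> in nhds 0. measure circle {x \<in> D. rotation \<delta> x \<notin> D} < measure circle D"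
    using order_tendstoD(2)[OF tendsto_measure_rotation_leaves[OF D] pos] .
  then obtain r where r: "r > 0"
    "\<And>\<delta>. \<bar>\<delta>\<bar> < r \<Longrightarrow> measure circle {x \<in> D. rotation \<delta> x \<notin> D} < measure circle D"
    unfolding eventually_nhds_metric by (auto simp: dist_real_def)
  obtain h k where hk: "\<bar>of_int k * \<alpha> - of_int h - t\<bar> < r"
    using sequence_of_fractional_parts_is_dense[OF assms(1) r(1)] by blast
  define \<delta> where "\<delta> = of_int k * \<alpha> - of_int h - t"
  have "0 < measure circle D - measure circle {x \<in> D. rotation \<delta> x \<notin> D}"
    using r(2)[of \<delta>] hk by (simp add: \<delta>_def)
  also have "\<dots> = measure circle (D - {x \<in> D. rotation \<delta> x \<notin> D})"
    by (rule circle.finite_measure_Diff[symmetric])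
      (use D in \<open>auto intro: rotation_vimage_compl_sets\<close>)
  also have "\<dots> \<le> measure circle {x \<in> A. rotation (of_int k * \<alpha>) x \<in> B}"
  proof (rule circle.finite_measure_mono)
    show "D - {x \<in> D. rotation \<delta> x \<notin> D} \<subseteq> {x \<in> A. rotation (of_int k * \<alpha>) x \<in> B}"
    proof (intro subsetI CollectI conjI)
      fix x assume "x \<in> D - {x \<in> D. rotation \<delta> x \<notin> D}"
      then have x: "x \<in> D" "rotation \<delta> x \<in> D" by auto
      then show "x \<in> A" by (simp add: D_def)
      have "rotation (\<delta> + t) x \<in> B"
        using x(2) by (simp add: D_def rotation_rotation)
      then show "rotation (of_int k * \<alpha>) x \<in> B"
        using rotation_plus_int[of "\<delta> + t" h x] by (simp add: \<delta>_def)
    qed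
  qed (intro rotation_vimage_Int_sets assms)
  finally show ?thesis by (auto simp: circle.emeasure_eq_measure)
qed

text \<open>The uncovered sets \<open>R J\<close> decrease to a set whose orbits never meet
  \<open>A\<close>; by \<open>exists_orbit_meets\<close> that set is null, and continuity from above
  yields \<open>J\<close>.\<close>

lemma orbit_almost_covers:
  assumes "\<alpha> \<notin> \<rat>" "A \<in> sets circle" "emeasure circle A > 0" "e > 0"
  shows "\<exists>J::nat. measure circle
    ({0..<1} - (\<Union>j\<in>{- int J..int J}. {x \<in> {0..<1}. rotation (of_int j * \<alpha>) x \<in> A})) < e"
proof -
  define R where "R J = {0..<1} -
    (\<Union>j\<in>{- int J..int J}. {x \<in> {0..<1}. rotation (of_int j * \<alpha>) x \<in> A})" for J
  have R [measurable]: "R J \<in> sets circle" for J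
    unfolding R_def using assms(2)
    by (intro sets.Diff sets.finite_UN rotation_vimage_sets) (auto simp: sets_circle_iff)
  have "decseq R" unfolding R_def decseq_def by fastforce
  then have lim: "(\<lambda>J. measure circle (R J)) \<longlonglongrightarrow> measure circle (\<Inter>J. R J)"
    by (intro circle.finite_Lim_measure_decseq) (auto intro: R)
  have "measure circle (\<Inter>J. R J) = 0"
  proof (rule ccontr)
    assume "measure circle (\<Inter>J. R J) \<noteq> 0"
    then have "emeasure circle (\<Inter>J. R J) > 0"
      by (simp add: circle.emeasure_eq_measure zero_less_measure_iff)
    moreover have "(\<Inter>J. R J) \<in> sets circle" by measurable
    ultimately obtain n :: int
      where n: "emeasure circle {x \<in> \<Inter>J. R J. rotation (of_int n * \<alpha>) x \<in> A} > 0"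
      using exists_orbit_meets[OF assms(1) _ assms(2) _ assms(3)] by blast
    have "{x \<in> \<Inter>J. R J. rotation (of_int n * \<alpha>) x \<in> A} = {}"
    proof (rule ccontr)
      assume "\<not> ?thesis"
      then obtain x where x: "\<And>J. x \<in> R J" "rotation (of_int n * \<alpha>) x \<in> A" by blast
      have "n \<in> {- int (nat \<bar>n\<bar>)..int (nat \<bar>n\<bar>)}" by auto
      then show False using x(1)[of "nat \<bar>n\<bar>"] x(2) unfolding R_def by blast
    qed
    then show False using n by (simp only: emeasure_empty less_irrefl)
  qed
  then have "\<forall>\<^sub>F J in sequentially. measure circle (R J) < e"
    using order_tendstoD(2)[OF lim] assms(4) by simp
  then show ?thesis unfolding R_def by (meson eventually_happens sequentially_bot)
qed

section \<open>Essential values and rigid times\<close>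

text \<open>Composition with small rotations is continuous in measure, with no integrability of
  \<open>h\<close>. The range is separable, so the preimages \<open>A i\<close> of countably many
  balls of radius \<open>\<epsilon> / 2\<close> cover the circle, and finitely many of them cover
  all but little of it. A point of \<open>A i\<close> whose value changes by
  \<open>\<epsilon>\<close> or more must leave \<open>A i\<close>, which is rare for each of these
  finitely many \<open>i\<close>.\<close>

lemma tendsto_in_measure_rotation:
  fixes h :: "real \<Rightarrow> 'b::{metric_space, second_countable_topology}"
  assumes h [measurable]: "h \<in> borel_measurable circle" and "\<epsilon> > 0"
  shows "((\<lambda>\<delta>. measure circle {x \<in> {0..<1}. \<epsilon> \<le> dist (h (rotation \<delta> x)) (h x)}) \<longlongrightarrow> 0) (nhds 0)"
proof -
  obtain D :: "'b set" where D: "countable D" "\<And>X. open X \<Longrightarrow> X \<noteq> {} \<Longrightarrow> \<exists>d\<in>D. d \<in> X"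
    using countable_dense_exists by blast
  then have "D \<noteq> {}" using D(2)[of UNIV] by auto
  define A where "A i = {x \<in> {0..<1}. h x \<in> ball (from_nat_into D i) (\<epsilon> / 2)}" for i
  have A: "A i \<in> sets circle" for i
  proof -
    have "A i = h -` ball (from_nat_into D i) (\<epsilon> / 2) \<inter> space circle"
      by (auto simp: A_def)
    then show ?thesis using measurable_sets[OF h, of "ball (from_nat_into D i) (\<epsilon> / 2)"] by simp
  qed
  have cover: "\<exists>i. x \<in> A i" if "x \<in> {0..<1}" for x
  proof -
    obtain d where "d \<in> D" "d \<in> ball (h x) (\<epsilon> / 2)"
      using D(2)[of "ball (h x) (\<epsilon> / 2)"] \<open>\<epsilon> > 0\<close> by auto
    then show ?thesis
      using from_nat_into_surj[OF D(1), of d] that by (auto simp: A_def dist_commute)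
  qed
  define R where "R I = {0..<1} - (\<Union>i<I. A i)" for I :: nat
  have R: "R I \<in> sets circle" for I
    unfolding R_def using A by (intro sets.Diff sets.finite_UN) (auto simp: sets_circle_iff)
  have "decseq R" unfolding R_def decseq_def by fastforce
  then have "(\<lambda>I. measure circle (R I)) \<longlonglongrightarrow> measure circle (\<Inter>I. R I)"
    by (intro circle.finite_Lim_measure_decseq) (auto intro: R)
  moreover have "(\<Inter>I. R I) = {}"
    using cover unfolding R_def by fastforce
  ultimately have limR: "(\<lambda>I. measure circle (R I)) \<longlonglongrightarrow> 0" by simp
  show ?thesis
  proof (rule tendstoI)
    fix e :: real assume "e > 0"
    then have "\<forall>\<^sub>F I in sequentially. measure circle (R I) < e / 2"
      using order_tendstoD(2)[OF limR, of "e / 2"] by simp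
    then obtain I where I: "measure circle (R I) < e / 2"
      by (meson eventually_happens sequentially_bot)
    have "((\<lambda>\<delta>. \<Sum>i<I. measure circle {x \<in> A i. rotation \<delta> x \<notin> A i}) \<longlongrightarrow> 0) (nhds 0)"
      by (intro tendsto_null_sum tendsto_measure_rotation_leaves A)
    then have "\<forall>\<^sub>F \<delta> in nhds 0. (\<Sum>i<I. measure circle {x \<in> A i. rotation \<delta> x \<notin> A i}) < e / 2"
      by (rule order_tendstoD(2)) (simp add: \<open>e > 0\<close>)
    then show "\<forall>\<^sub>F \<delta> in nhds 0.
        dist (measure circle {x \<in> {0..<1}. \<epsilon> \<le> dist (h (rotation \<delta> x)) (h x)}) 0 < e"
    proof eventually_elim
      case (elim \<delta>)
      let ?L = "\<lambda>i. {x \<in> A i. rotation \<delta> x \<notin> A i}"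
      have L: "?L i \<in> sets circle" for i
        by (intro rotation_vimage_compl_sets A)
      have "measure circle {x \<in> {0..<1}. \<epsilon> \<le> dist (h (rotation \<delta> x)) (h x)} \<le>
          measure circle (R I \<union> (\<Union>i<I. ?L i))"
      proof (rule circle.finite_measure_mono)
        show "{x \<in> {0..<1}. \<epsilon> \<le> dist (h (rotation \<delta> x)) (h x)} \<subseteq> R I \<union> (\<Union>i<I. ?L i)"
        proof
          fix x assume x: "x \<in> {x \<in> {0..<1}. \<epsilon> \<le> dist (h (rotation \<delta> x)) (h x)}"
          show "x \<in> R I \<union> (\<Union>i<I. ?L i)"
          proof (cases "x \<in> R I")
            case False
            then obtain i where i: "i < I" "x \<in> A i" using x by (auto simp: R_def)
            have "rotation \<delta> x \<notin> A i"
            proof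
              assume "rotation \<delta> x \<in> A i"
              then have "dist (h (rotation \<delta> x)) (h x) < \<epsilon> / 2 + \<epsilon> / 2"
                using i(2) unfolding A_def
                by (intro dist_triangle_less_add[of _ "from_nat_into D i"])
                  (auto simp: dist_commute)
              then show False using x by simp
            qed
            then show ?thesis using i by blast
          qed simp
        qed
        show "R I \<union> (\<Union>i<I. ?L i) \<in> sets circle"
          using R L by (intro sets.Un sets.finite_UN) auto
      qed
      also have "\<dots> \<le> measure circle (R I) + measure circle (\<Union>i<I. ?L i)"
        using R L by (intro measure_circle_Un_le sets.finite_UN) auto
      also have "\<dots> \<le> measure circle (R I) + (\<Sum>i<I. measure circle (?L i))"
        using L by (intro add_left_mono circle.finite_measure_subadditive_finite) auto
      also have "\<dots> < e" using I elim by simp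
      finally show ?case by simp
    qed
  qed
qed

section \<open>Cocycles over a rotation and differences of essential values\<close>

lemma iterate_rotation_eq:
  "x \<in> {0..<1} \<Longrightarrow> iterate circle (rotation \<alpha>) n x = rotation (of_int n * \<alpha>) x"
  by (simp add: iterate_rotation rotation_def)

lemma funpow_rotation:
  "x \<in> {0..<1} \<Longrightarrow> (rotation \<alpha> ^^ k) x = rotation (real k * \<alpha>) x"
  using iterate_rotation_eq[of x \<alpha> "int k"] by (simp add: iterate_def)

lemma cocycle_sum_rotation_add:
  assumes "x \<in> {0..<1}"
  shows "cocycle_sum circle (rotation \<alpha>) \<Phi> (n + k) x =
    cocycle_sum circle (rotation \<alpha>) \<Phi> n x +
    cocycle_sum circle (rotation \<alpha>) \<Phi> k (rotation (of_int n * \<alpha>) x)"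
  using cocycle_sum_add[OF bij_betw_rotation, of x \<alpha> \<Phi> n k] assms
  by (simp add: iterate_rotation_eq)

lemma cocycle_sum_measurable:
  fixes \<Phi> :: "real \<Rightarrow> real ^ 'm::finite"
  assumes [measurable]: "\<Phi> \<in> borel_measurable circle"
  shows "cocycle_sum circle (rotation \<alpha>) \<Phi> n \<in> borel_measurable circle"
proof -
  let ?S = "\<lambda>x. if n \<ge> 0 then \<Sum>k<nat n. \<Phi> (rotation (real k * \<alpha>) x)
    else - (\<Sum>k<nat (- n). \<Phi> (rotation (real k * \<alpha>) (rotation (of_int n * \<alpha>) x)))"
  have "cocycle_sum circle (rotation \<alpha>) \<Phi> n x = ?S x" if "x \<in> space circle" for x
    using that by (simp add: cocycle_sum_def iterate_rotation_eq funpow_rotation)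
  moreover have "?S \<in> borel_measurable circle" by measurable
  ultimately show ?thesis by (subst measurable_cong[where g = ?S]) auto
qed

lemma essential_value_rotation_iff:
  "essential_value circle (rotation \<alpha>) \<Phi> g \<longleftrightarrow>
    (\<forall>U A. open U \<and> g \<in> U \<and> A \<in> sets circle \<and> measure circle A > 0 \<longrightarrow>
      (\<exists>N::int. measure circle {x \<in> A. rotation (of_int N * \<alpha>) x \<in> A \<and>
        cocycle_sum circle (rotation \<alpha>) \<Phi> N x \<in> U} > 0))"
proof -
  have "A \<inter> {x \<in> space circle. iterate circle (rotation \<alpha>) N x \<in> A} \<inter>
      {x \<in> space circle. cocycle_sum circle (rotation \<alpha>) \<Phi> N x \<in> U} =
      {x \<in> A. rotation (of_int N * \<alpha>) x \<in> A \<and> cocycle_sum circle (rotation \<alpha>) \<Phi> N x \<in> U}"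
    if "A \<in> sets circle" for A N U
    using that by (auto simp: iterate_rotation_eq sets_circle_iff)
  then show ?thesis
    unfolding essential_value_def
    by (simp add: circle.emeasure_eq_measure cong: conj_cong)
qed

lemma return_set_measurable:
  fixes \<Phi> :: "real \<Rightarrow> real ^ 'm::finite"
  assumes "\<Phi> \<in> borel_measurable circle" "A \<in> sets circle" "B \<in> sets circle" "open U"
  shows "{x \<in> A. rotation t x \<in> B \<and> cocycle_sum circle (rotation \<alpha>) \<Phi> N x \<in> U} \<in> sets circle"
proof -
  let ?S = "cocycle_sum circle (rotation \<alpha>) \<Phi> N"
  have "{x \<in> A. rotation t x \<in> B \<and> ?S x \<in> U} =
      {x \<in> A. rotation t x \<in> B} \<inter> (?S -` U \<inter> space circle)"
    using assms(2) by (auto simp: sets_circle_iff)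
  also have "\<dots> \<in> sets circle"
    by (intro sets.Int rotation_vimage_Int_sets assms(2,3)
        measurable_sets[OF cocycle_sum_measurable[OF assms(1)]] borel_open assms(4))
  finally show ?thesis .
qed

text \<open>Choose a return time \<open>N\<close> for \<open>h\<close> on \<open>A\<close>, then a
  return time \<open>K\<close> for \<open>g\<close> on the resulting set \<open>C N\<close>. For
  \<open>x\<close> in \<open>D K\<close> both the \<open>N\<close>-th and the \<open>K\<close>-th
  iterate of \<open>x\<close> lie in \<open>A\<close>; passing from the former to the latter takes
  time \<open>K - N\<close> and adds \<open>?S K x - ?S N x\<close>, which is close to
  \<open>g - h\<close>.\<close>

lemma essential_value_diff:
  fixes \<Phi> :: "real \<Rightarrow> real ^ 'm::finite"
  assumes \<Phi>: "\<Phi> \<in> borel_measurable circle"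
    and g: "essential_value circle (rotation \<alpha>) \<Phi> g"
    and h: "essential_value circle (rotation \<alpha>) \<Phi> h"
  shows "essential_value circle (rotation \<alpha>) \<Phi> (g - h)"
  unfolding essential_value_rotation_iff
proof (intro allI impI, elim conjE)
  fix U :: "(real ^ 'm) set" and A
  assume U: "open U" "g - h \<in> U" and A: "A \<in> sets circle" "measure circle A > 0"
  let ?S = "cocycle_sum circle (rotation \<alpha>) \<Phi>"
  obtain e where e: "e > 0" "ball (g - h) e \<subseteq> U"
    using U openE by blast
  define C where "C N = {x \<in> A. rotation (of_int N * \<alpha>) x \<in> A \<and> ?S N x \<in> ball h (e / 2)}" for N
  obtain N where N: "measure circle (C N) > 0"
    using h[unfolded essential_value_rotation_iff, rule_format, of "ball h (e / 2)" A] A e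
    unfolding C_def by auto
  have C: "C N \<in> sets circle"
    unfolding C_def by (intro return_set_measurable \<Phi> A) auto
  define D where "D K = {x \<in> C N. rotation (of_int K * \<alpha>) x \<in> C N \<and> ?S K x \<in> ball g (e / 2)}" for K
  obtain K where K: "measure circle (D K) > 0"
    using g[unfolded essential_value_rotation_iff, rule_format, of "ball g (e / 2)" "C N"] C N e
    unfolding D_def by auto
  have D: "D K \<in> sets circle"
    unfolding D_def by (intro return_set_measurable \<Phi> C) auto
  \<comment> \<open>This is the image of \<open>D K\<close> under the \<open>N\<close>-th iterate,
    written as a preimage under the inverse so that invariance of the measure applies.\<close>
  have "0 < measure circle {y \<in> {0..<1}. rotation (of_int (- N) * \<alpha>) y \<in> D K}"
    using K measure_rotation_vimage[OF D] by simp
  also have "\<dots> \<le> measure circle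
      {y \<in> A. rotation (of_int (K - N) * \<alpha>) y \<in> A \<and> ?S (K - N) y \<in> U}"
  proof (rule circle.finite_measure_mono)
    show "{y \<in> {0..<1}. rotation (of_int (- N) * \<alpha>) y \<in> D K} \<subseteq>
        {y \<in> A. rotation (of_int (K - N) * \<alpha>) y \<in> A \<and> ?S (K - N) y \<in> U}"
    proof
      fix y assume "y \<in> {y \<in> {0..<1}. rotation (of_int (- N) * \<alpha>) y \<in> D K}"
      then have y: "y \<in> {0..<1}" and D': "rotation (of_int (- N) * \<alpha>) y \<in> D K" by auto
      define x where "x = rotation (of_int (- N) * \<alpha>) y"
      have x: "x \<in> {0..<1}" by (simp add: x_def)
      have "x \<in> C N" "rotation (of_int K * \<alpha>) x \<in> C N" "?S K x \<in> ball g (e / 2)"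
        using D' by (auto simp: D_def x_def)
      then have 1: "rotation (of_int N * \<alpha>) x \<in> A" "rotation (of_int K * \<alpha>) x \<in> A"
        "dist h (?S N x) < e / 2" "dist g (?S K x) < e / 2"
        by (auto simp: C_def)
      have xy: "rotation (of_int N * \<alpha>) x = y"
        using y by (simp add: x_def rotation_rotation rotation_0)
      have rot: "rotation (of_int (K - N) * \<alpha>) y = rotation (of_int K * \<alpha>) x"
        by (simp add: x_def rotation_rotation algebra_simps)
      have eq: "?S (K - N) y = ?S K x - ?S N x"
        using cocycle_sum_rotation_add[OF x, of \<alpha> \<Phi> N "K - N"] by (simp add: xy)
      have "dist (g - h) (?S (K - N) y) \<le> dist g (?S K x) + dist h (?S N x)"
        using norm_triangle_ineq4[of "g - ?S K x" "h - ?S N x"]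
        unfolding dist_norm eq by (simp add: algebra_simps)
      then have "?S (K - N) y \<in> U" using e(2) 1(3,4) by (auto intro!: subsetD[OF e(2)])
      then show "y \<in> {y \<in> A. rotation (of_int (K - N) * \<alpha>) y \<in> A \<and> ?S (K - N) y \<in> U}"
        using 1 xy rot by simp
    qed
    show "{y \<in> A. rotation (of_int (K - N) * \<alpha>) y \<in> A \<and> ?S (K - N) y \<in> U} \<in> sets circle"
      by (intro return_set_measurable \<Phi> A U)
  qed
  finally show "\<exists>N. measure circle
      {x \<in> A. rotation (of_int N * \<alpha>) x \<in> A \<and> ?S N x \<in> U} > 0" by blast
qed

section \<open>A criterion for essential values along rigid times\<close>

text \<open>The hypothesis \<open>freq\<close> speaks of visits on the whole circle; ergodicity
  brings them into a given \<open>A\<close>. Finitely many rotated copies \<open>V j\<close> of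
  \<open>A\<close> cover so much that one of them contains a fixed share of the visiting points.
  Rotating these by \<open>j * \<alpha>\<close> lands in \<open>A\<close> and hardly changes the sum
  at time \<open>Q n\<close>, while rigidity makes most points of \<open>A\<close> return to
  \<open>A\<close> at that time. Infinitely many good \<open>n\<close> suffice, since the error
  bounds hold eventually.\<close>

lemma essential_value_of_rigid_times:
  fixes \<Phi> :: "real \<Rightarrow> real ^ 'm::finite" and Q P :: "nat \<Rightarrow> int"
  assumes \<alpha>: "\<alpha> \<notin> \<rat>" and \<Phi> [measurable]: "\<Phi> \<in> borel_measurable circle"
    and rigid: "(\<lambda>n. of_int (Q n) * \<alpha> - of_int (P n)) \<longlonglongrightarrow> 0"
    and freq: "\<And>U. open U \<Longrightarrow> g \<in> U \<Longrightarrow> \<exists>\<eta>>0. \<exists>\<^sub>F n in sequentially.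
      measure circle {x \<in> {0..<1}. cocycle_sum circle (rotation \<alpha>) \<Phi> (Q n) x \<in> U} \<ge> \<eta>"
  shows "essential_value circle (rotation \<alpha>) \<Phi> g"
  unfolding essential_value_rotation_iff
proof (intro allI impI, elim conjE)
  fix U :: "(real ^ 'm) set" and A
  assume U: "open U" "g \<in> U" and A: "A \<in> sets circle" "measure circle A > 0"
  let ?S = "cocycle_sum circle (rotation \<alpha>) \<Phi>"
  have S [measurable]: "?S n \<in> borel_measurable circle" for n
    by (intro cocycle_sum_measurable \<Phi>)
  define \<delta> where "\<delta> n = of_int (Q n) * \<alpha> - of_int (P n)" for n
  have \<delta>0: "filterlim \<delta> (nhds 0) sequentially" using rigid by (simp add: \<delta>_def [abs_def])
  have rot\<delta>: "rotation (of_int (Q n) * \<alpha>) x = rotation (\<delta> n) x" for n x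
    using rotation_plus_int[of "\<delta> n" "P n" x] by (simp add: \<delta>_def)
  obtain e where e: "e > 0" "ball g (2 * e) \<subseteq> U"
    using openE[OF U] by (metis field_sum_of_halves half_gt_zero mult_2)
  obtain \<eta> where \<eta>: "\<eta> > 0"
    "\<exists>\<^sub>F n in sequentially. measure circle {x \<in> {0..<1}. ?S (Q n) x \<in> ball g e} \<ge> \<eta>"
    using freq[of "ball g e"] e by auto
  define V where "V j = {x \<in> {0..<1}. rotation (of_int j * \<alpha>) x \<in> A}" for j :: int
  have V: "V j \<in> sets circle" for j
    unfolding V_def by (intro rotation_vimage_sets A)
  obtain J :: nat where J: "measure circle ({0..<1} - (\<Union>j\<in>{- int J..int J}. V j)) < \<eta> / 2"
    using orbit_almost_covers[OF \<alpha> A(1), of "\<eta> / 2"] A(2) \<eta>(1)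
    by (auto simp: V_def circle.emeasure_eq_measure)
  define F where "F = {- int J..int J}"
  have F: "finite F" "F \<noteq> {}" by (auto simp: F_def)
  \<comment> \<open>At most \<open>\<eta> / 2\<close> of the visits is lost outside the copies
    \<open>V j\<close>; the other half is shared among \<open>card F\<close> indices.\<close>
  define \<kappa> where "\<kappa> = \<eta> / (2 * card F)"
  have \<kappa>: "\<kappa> > 0" using F \<eta>(1) by (simp add: \<kappa>_def card_gt_0_iff)
  define E where "E n = {x \<in> {0..<1}. ?S (Q n) x \<in> ball g e}" for n
  have E: "E n \<in> sets circle" for n
  proof -
    have "E n = ?S (Q n) -` ball g e \<inter> space circle" by (auto simp: E_def)
    then show ?thesis using measurable_sets[OF S, of "ball g e"] by simp
  qed
  have "\<exists>j\<in>F. measure circle (E n \<inter> V j) \<ge> \<kappa>" if "measure circle (E n) \<ge> \<eta>" for n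
  proof (rule ccontr)
    assume c: "\<not> ?thesis"
    have "E n \<subseteq> (\<Union>j\<in>F. E n \<inter> V j) \<union> ({0..<1} - (\<Union>j\<in>F. V j))"
      by (auto simp: E_def)
    then have "measure circle (E n) \<le>
        measure circle ((\<Union>j\<in>F. E n \<inter> V j) \<union> ({0..<1} - (\<Union>j\<in>F. V j)))"
      using E V F by (intro circle.finite_measure_mono sets.Un sets.Diff sets.finite_UN)
        (auto simp: sets_circle_iff)
    also have "\<dots> \<le> measure circle (\<Union>j\<in>F. E n \<inter> V j) + measure circle ({0..<1} - (\<Union>j\<in>F. V j))"
      using E V F by (intro measure_circle_Un_le sets.Diff sets.finite_UN)
        (auto simp: sets_circle_iff)
    also have "\<dots> < (\<Sum>j\<in>F. measure circle (E n \<inter> V j)) + \<eta> / 2"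
      using J E V F by (intro add_le_less_mono circle.finite_measure_subadditive_finite)
        (auto simp: F_def)
    also have "(\<Sum>j\<in>F. measure circle (E n \<inter> V j)) \<le> card F * \<kappa>"
      using c by (intro sum_bounded_above) (auto simp: not_le less_imp_le)
    also have "card F * \<kappa> = \<eta> / 2" using F by (simp add: \<kappa>_def field_simps)
    finally show False using that by simp
  qed
  then have f1: "\<exists>\<^sub>F n in sequentially. \<exists>j\<in>F. measure circle (E n \<inter> V j) \<ge> \<kappa>"
    using \<eta>(2) by (auto simp: E_def elim!: frequently_mono[rotated])
  define B where "B n j = {x \<in> {0..<1}. e \<le> dist (?S j (rotation (\<delta> n) x)) (?S j x)}" for n j
  have B: "B n j \<in> sets circle" for n j
  proof -
    have "B n j = {x \<in> space circle. e \<le> dist (?S j (rotation (\<delta> n) x)) (?S j x)}"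
      by (simp add: B_def)
    also have "\<dots> \<in> sets circle" by measurable
    finally show ?thesis .
  qed
  define L where "L n = {x \<in> A. rotation (\<delta> n) x \<notin> A}" for n
  have L: "L n \<in> sets circle" for n
    unfolding L_def by (intro rotation_vimage_compl_sets A)
  have "\<forall>\<^sub>F n in sequentially. \<forall>j\<in>F. measure circle (B n j) < \<kappa> / 2"
  proof (intro eventually_ball_finite ballI F)
    fix j assume "j \<in> F"
    have "(\<lambda>n. measure circle (B n j)) \<longlonglongrightarrow> 0"
      unfolding B_def
      by (rule filterlim_compose[OF tendsto_in_measure_rotation[OF S e(1)] \<delta>0])
    then show "\<forall>\<^sub>F n in sequentially. measure circle (B n j) < \<kappa> / 2"
      using \<kappa> by (intro order_tendstoD(2)) auto
  qed
  moreover have "\<forall>\<^sub>F n in sequentially. measure circle (L n) < \<kappa> / 2"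
  proof -
    have "(\<lambda>n. measure circle (L n)) \<longlonglongrightarrow> 0"
      unfolding L_def
      by (rule filterlim_compose[OF tendsto_measure_rotation_leaves[OF A(1)] \<delta>0])
    then show ?thesis using \<kappa> by (intro order_tendstoD(2)) auto
  qed
  ultimately have ev: "\<forall>\<^sub>F n in sequentially.
      (\<forall>j\<in>F. measure circle (B n j) < \<kappa> / 2) \<and> measure circle (L n) < \<kappa> / 2"
    by (rule eventually_conj)
  obtain n where "(\<exists>j\<in>F. measure circle (E n \<inter> V j) \<ge> \<kappa>)"
      "(\<forall>j\<in>F. measure circle (B n j) < \<kappa> / 2) \<and> measure circle (L n) < \<kappa> / 2"
    using frequently_ex[OF frequently_eventually_conj[OF f1 ev]] by blast
  then obtain j where n: "j \<in> F" "measure circle (E n \<inter> V j) \<ge> \<kappa>"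
      "measure circle (B n j) < \<kappa> / 2" "measure circle (L n) < \<kappa> / 2"
    by blast
  let ?T = "{x \<in> A. rotation (of_int (Q n) * \<alpha>) x \<in> A \<and> ?S (Q n) x \<in> U}"
  let ?L = "{x \<in> {0..<1}. rotation (of_int j * \<alpha>) x \<in> L n}"
  have T: "?T \<in> sets circle" by (intro return_set_measurable \<Phi> A U)
  have L': "?L \<in> sets circle" by (intro rotation_vimage_sets L)
  \<comment> \<open>The two exceptional sets have measure below \<open>\<kappa> / 2\<close> each, so
    the left side, of measure at least \<open>\<kappa>\<close>, leaves positive measure for the
    preimage of \<open>?T\<close>.\<close>
  have "E n \<inter> V j \<subseteq> (B n j \<union> ?L) \<union> {x \<in> {0..<1}. rotation (of_int j * \<alpha>) x \<in> ?T}"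
  proof (intro subsetI)
    fix x assume "x \<in> E n \<inter> V j"
    then have x: "x \<in> {0..<1}" "dist g (?S (Q n) x) < e" "rotation (of_int j * \<alpha>) x \<in> A"
      by (auto simp: E_def V_def)
    let ?y = "rotation (of_int j * \<alpha>) x"
    show "x \<in> (B n j \<union> ?L) \<union> {x \<in> {0..<1}. rotation (of_int j * \<alpha>) x \<in> ?T}"
    proof (cases "x \<in> B n j \<union> ?L")
      case False
      then have 1: "dist (?S j (rotation (\<delta> n) x)) (?S j x) < e" "rotation (\<delta> n) ?y \<in> A"
        using x by (auto simp: B_def L_def)
      \<comment> \<open>The two ways of splitting \<open>?S (j + Q n) x\<close> make \<open>?S (Q n)\<close> almost invariant under the rotation.\<close>
      have "?S j x + ?S (Q n) ?y = ?S (Q n) x + ?S j (rotation (\<delta> n) x)"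
        using cocycle_sum_rotation_add[OF x(1), of \<alpha> \<Phi> j "Q n"]
          cocycle_sum_rotation_add[OF x(1), of \<alpha> \<Phi> "Q n" j]
        by (simp add: add.commute rot\<delta>)
      then have "?S (Q n) ?y = ?S (Q n) x + (?S j (rotation (\<delta> n) x) - ?S j x)"
        by (simp add: algebra_simps)
      then have "dist (?S (Q n) x) (?S (Q n) ?y) < e"
        using 1(1) by (simp add: dist_norm norm_minus_commute)
      then have "dist g (?S (Q n) ?y) < 2 * e"
        using x(2) dist_triangle[of g "?S (Q n) ?y" "?S (Q n) x"] by linarith
      then have "?S (Q n) ?y \<in> U" using e(2) by auto
      then show ?thesis using x 1(2) by (simp add: rot\<delta>)
    qed simp
  qed
  then have "measure circle (E n \<inter> V j) \<le>
      measure circle ((B n j \<union> ?L) \<union> {x \<in> {0..<1}. rotation (of_int j * \<alpha>) x \<in> ?T})"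
    by (rule circle.finite_measure_mono) (intro sets.Un B L' rotation_vimage_sets T)
  also have "\<dots> \<le> measure circle (B n j \<union> ?L) +
      measure circle {x \<in> {0..<1}. rotation (of_int j * \<alpha>) x \<in> ?T}"
    by (intro measure_circle_Un_le sets.Un B L' rotation_vimage_sets T)
  also have "\<dots> \<le> measure circle (B n j) + measure circle ?L +
      measure circle {x \<in> {0..<1}. rotation (of_int j * \<alpha>) x \<in> ?T}"
    by (intro add_right_mono measure_circle_Un_le B L')
  also have "\<dots> = measure circle (B n j) + measure circle (L n) + measure circle ?T"
    by (simp only: measure_rotation_vimage L T)
  finally show "\<exists>N. measure circle
      {x \<in> A. rotation (of_int N * \<alpha>) x \<in> A \<and> ?S N x \<in> U} > 0"
    using n by (intro exI[of _ "Q n"]) linarith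
qed

section \<open>The sawtooth cocycle\<close>

text \<open>For \<open>1 \<le> j \<le> q - 2\<close> the interval allowed for \<open>v\<close> lies
  inside \<open>[0, 1)\<close> and \<open>frac\<close> changes nothing. For the two extreme residues
  the trivial bound 1 is used; writing it with \<open>of_bool\<close> makes the total over all
  residues easy to compute.\<close>

lemma abs_frac_diff_le:
  fixes v :: real and q j :: int
  assumes "0 \<le> j" "j < q" "\<bar>v - of_int j / of_int q\<bar> \<le> 2 / of_int q"
    and "(of_int j - 1) / of_int q < v" "v < (of_int j + 2) / of_int q"
  shows "\<bar>frac v - of_int j / of_int q\<bar> \<le> 2 / of_int q + (of_bool (j = 0) + of_bool (j = q - 1))"
proof (cases "j = 0 \<or> j = q - 1")
  case True
  have "0 \<le> of_int j / (of_int q :: real)" "of_int j / (of_int q :: real) \<le> 1"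
    "0 \<le> 2 / (of_int q :: real)"
    using assms by simp_all
  moreover have "0 \<le> frac v" "frac v < 1" by (simp_all add: frac_lt_1)
  ultimately have "\<bar>frac v - of_int j / of_int q\<bar> \<le> 1" by linarith
  moreover have "1 \<le> (of_bool (j = 0) + of_bool (j = q - 1) :: real)" using True by auto
  ultimately show ?thesis using \<open>0 \<le> 2 / (of_int q :: real)\<close> by linarith
next
  case False
  then have j: "1 \<le> j" "j + 2 \<le> q" using assms by auto
  have "0 \<le> (of_int j - 1) / (of_int q :: real)" using j by simp
  moreover have "(of_int j + 2) / (of_int q :: real) \<le> 1"
    using j by (simp add: divide_simps)
  ultimately have "frac v = v" unfolding frac_eq using assms by linarith
  then show ?thesis using assms False by simp
qed

lemma bij_betw_add_mult_mod:
  fixes a p :: int and q :: nat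
  assumes "coprime p (int q)" "q > 0"
  shows "bij_betw (\<lambda>k. (a + int k * p) mod int q) {..<q} {0..<int q}"
proof -
  have "inj_on (\<lambda>k. (a + int k * p) mod int q) {..<q}"
  proof (rule inj_onI)
    fix k l assume kl: "k \<in> {..<q}" "l \<in> {..<q}"
      and "(a + int k * p) mod int q = (a + int l * p) mod int q"
    then have "int q dvd (int k - int l) * p"
      by (simp add: mod_eq_dvd_iff algebra_simps)
    then have "int q dvd int k - int l"
      using assms(1) by (simp add: coprime_dvd_mult_left_iff coprime_commute)
    then have "int k mod int q = int l mod int q" by (simp add: mod_eq_dvd_iff)
    then show "k = l" using kl by simp
  qed
  moreover have "(\<lambda>k. (a + int k * p) mod int q) ` {..<q} \<subseteq> {0..<int q}"
    using assms(2) by auto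
  moreover have "card {0..<int q} = card {..<q}" by simp
  ultimately show ?thesis
    unfolding bij_betw_def by (metis card_image card_subset_eq finite_atLeastLessThan_int)
qed

lemma abs_sum_psi_le:
  fixes p :: int and q :: nat
  assumes cop: "coprime p (int q)" and "q > 0" and app: "\<bar>\<alpha> - of_int p / real q\<bar> < 1 / (real q)\<^sup>2"
  shows "\<bar>\<Sum>k<q. psi (x + real k * \<alpha>)\<bar> \<le> 5"
proof -
  \<comment> \<open>\<open>x + k\<alpha>\<close> is within \<open>2/q\<close> of \<open>j k / q\<close> modulo 1, and \<open>j\<close> permutes the residues modulo \<open>q\<close>;
    only the residues \<open>0\<close> and \<open>q - 1\<close> can be separated from their point by the jump of \<open>frac\<close>.\<close>
  define j where "j k = (\<lfloor>real q * x\<rfloor> + int k * p) mod int q" for k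
  have bij: "bij_betw j {..<q} {0..<int q}"
    unfolding j_def using bij_betw_add_mult_mod[OF cop \<open>q > 0\<close>] .
  have reindex: "(\<Sum>k<q. G (j k)) = (\<Sum>i\<in>{0..<int q}. G i)" for G :: "int \<Rightarrow> real"
    using sum.reindex_bij_betw[OF bij] .
  have q: "real q > 0" using \<open>q > 0\<close> by simp
  let ?G = "\<lambda>i. 2 / real q + (of_bool (i = 0) + of_bool (i = int q - 1))"
  have dev: "\<bar>frac (x + real k * \<alpha>) - of_int (j k) / real q\<bar> \<le> ?G (j k)" if "k < q" for k
  proof -
    define m where "m = (\<lfloor>real q * x\<rfloor> + int k * p) div int q"
    define v where "v = x + real k * \<alpha> - of_int m"
    define \<theta> where "\<theta> = \<alpha> - of_int p / real q"
    have "\<lfloor>real q * x\<rfloor> + int k * p = int q * m + j k" by (simp add: m_def j_def)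
    then have "of_int (\<lfloor>real q * x\<rfloor> + int k * p) = (of_int (int q * m + j k) :: real)" by simp
    then have e: "of_int \<lfloor>real q * x\<rfloor> + real k * of_int p = real q * of_int m + of_int (j k)" by simp
    \<comment> \<open>The second term on the right lies in \<open>[0, 1)\<close>, and the third is
      below 1 in absolute value because \<open>k < q\<close> and \<theta> is less than
      \<open>1 / q^2\<close> in absolute value. Hence \<open>real q * v\<close> is between
      \<open>j k - 1\<close> and \<open>j k + 2\<close>.\<close>
    have qv: "real q * v = of_int (j k) + frac (real q * x) + real q * (real k * \<theta>)"
    proof -
      have q\<alpha>: "real q * \<alpha> = real q * \<theta> + of_int p"
        using q by (simp add: \<theta>_def field_simps)
      have "real q * v = real q * x + real k * (real q * \<alpha>) - real q * of_int m"
        by (simp add: v_def algebra_simps)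
      then show ?thesis
        using e unfolding q\<alpha> by (simp add: frac_def algebra_simps)
    qed
    have "\<bar>real k * \<theta>\<bar> * real q < 1"
    proof -
      have "\<bar>\<theta>\<bar> * (real q * real q) < 1"
        using app q by (simp add: \<theta>_def power2_eq_square field_simps)
      moreover have "\<bar>real k * \<theta>\<bar> * real q \<le> \<bar>\<theta>\<bar> * (real q * real q)"
        using that by (simp add: abs_mult mult.commute mult_left_mono mult_right_mono)
      ultimately show ?thesis by linarith
    qed
    then have k: "\<bar>real q * (real k * \<theta>)\<bar> < 1" by (simp add: abs_mult mult.commute)
    have f: "0 \<le> frac (real q * x)" "frac (real q * x) < 1" by (simp_all add: frac_lt_1)
    have b: "of_int (j k) - 1 < real q * v" "real q * v < of_int (j k) + 2"
      using qv k f by linarith+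
    have jk: "0 \<le> j k" "j k < int q" using \<open>q > 0\<close> by (simp_all add: j_def)
    have "\<bar>frac v - of_int (j k) / of_int (int q)\<bar> \<le>
        2 / of_int (int q) + (of_bool (j k = 0) + of_bool (j k = int q - 1))"
    proof (rule abs_frac_diff_le[OF jk])
      show "(of_int (j k) - 1) / of_int (int q) < v" "v < (of_int (j k) + 2) / of_int (int q)"
        using b q by (simp_all add: field_simps)
      have "\<bar>real q * v - of_int (j k)\<bar> \<le> 2" using b by linarith
      moreover have "v - of_int (j k) / of_int (int q) = (real q * v - of_int (j k)) / real q"
        using q by (simp add: field_simps)
      ultimately show "\<bar>v - of_int (j k) / of_int (int q)\<bar> \<le> 2 / of_int (int q)"
        using q by (simp add: divide_right_mono)
    qed
    moreover have "frac v = frac (x + real k * \<alpha>)"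
      by (simp add: v_def frac_def)
    ultimately show ?thesis by simp
  qed
  have sum_j: "(\<Sum>k<q. of_int (j k) / real q) = (real q - 1) / 2"
  proof -
    have "(\<Sum>k<q. of_int (j k) / real q) = (\<Sum>i\<in>{0..<int q}. of_int i / real q)"
      by (rule reindex)
    also have "\<dots> = (\<Sum>k<q. real k / real q)"
      by (rule sum.reindex_bij_witness[of _ int nat]) auto
    also have "\<dots> = (\<Sum>k<q. real k) / real q" by (simp add: sum_divide_distrib)
    also have "(\<Sum>k<q. real k) = real q * (real q - 1) / 2"
      by (induction q) (auto simp: field_simps)
    finally show ?thesis using q by simp
  qed
  have "(\<Sum>k<q. ?G (j k)) = (\<Sum>i\<in>{0..<int q}. ?G i)" by (rule reindex)
  also have "\<dots> = 2 + (\<Sum>i\<in>{0..<int q}. of_bool (i = 0)) + (\<Sum>i\<in>{0..<int q}. of_bool (i = int q - 1))"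
    using q by (simp add: sum.distrib)
  also have "\<dots> \<le> 4"
    by (simp add: of_bool_def)
  finally have G: "(\<Sum>k<q. ?G (j k)) \<le> 4" .
  \<comment> \<open>The deviations from \<open>j k / q\<close> contribute at most 4, and the
    difference of \<open>(q - 1) / 2\<close> and \<open>q / 2\<close> contributes 1/2; the constant
    5 is 9/2 rounded up.\<close>
  have "(\<Sum>k<q. psi (x + real k * \<alpha>)) =
      (\<Sum>k<q. frac (x + real k * \<alpha>) - of_int (j k) / real q) + (real q - 1) / 2 - real q / 2"
    by (simp add: psi_def sum_subtractf sum_j)
  moreover have "\<bar>\<Sum>k<q. frac (x + real k * \<alpha>) - of_int (j k) / real q\<bar> \<le> (\<Sum>k<q. ?G (j k))"
    by (rule order_trans[OF sum_abs sum_mono]) (use dev in auto)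
  ultimately show ?thesis using G by (simp add: field_simps)
qed

section \<open>Motion of the sums along the diagonal\<close>

definition shift :: "('d \<Rightarrow> real) \<Rightarrow> 'd option \<Rightarrow> real" where
  "shift \<beta> i = (case i of None \<Rightarrow> 0 | Some j \<Rightarrow> \<beta> j)"

lemma cocycle_sum_Psi_nth:
  assumes "x \<in> {0..<1}"
  shows "cocycle_sum circle (rotation \<alpha>) (Psi \<beta>) (int q) x $ i =
    (\<Sum>k<q. psi (x + shift \<beta> i + real k * \<alpha>))"
proof -
  have "Psi \<beta> y $ i = psi (y + shift \<beta> i)" for y
    by (simp add: Psi_def shift_def split: option.split)
  moreover have "psi (rotation t x + s) = psi (x + s + t)" for s t
    unfolding psi_def rotation_def frac_add_frac by (simp add: algebra_simps)
  ultimately show ?thesis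
    using assms by (simp add: cocycle_sum_def funpow_rotation)
qed

text \<open>A point of this set can be moved right by up to \<open>c / q\<close> without any summand of the \<open>q\<close>-th sum
  jumping; as the unshifted coordinate with \<open>k = 0\<close> is included, it does not leave \<open>[0, 1)\<close> either.\<close>

definition jump_free :: "real \<Rightarrow> ('d::finite \<Rightarrow> real) \<Rightarrow> nat \<Rightarrow> real \<Rightarrow> real set" where
  "jump_free \<alpha> \<beta> q c =
    {x \<in> {0..<1}. \<forall>i. \<forall>k<q. rotation (shift \<beta> i + real k * \<alpha>) x < 1 - c / real q}"

text \<open>No fractional part reaches 1 on the way, so each of the \<open>q\<close> summands of
  every coordinate grows by exactly \<open>s / q\<close>.\<close>

lemma jump_free_translate:
  assumes x: "x \<in> jump_free \<alpha> \<beta> q c" and s: "0 \<le> s" "s \<le> c" and "q > 0"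
  shows "cocycle_sum circle (rotation \<alpha>) (Psi \<beta>) (int q) (rotation (s / real q) x) =
      cocycle_sum circle (rotation \<alpha>) (Psi \<beta>) (int q) x + (\<chi> i. s)"
proof -
  have x01: "x \<in> {0..<1}" using x by (simp add: jump_free_def)
  have sq: "0 \<le> s / real q" "s / real q \<le> c / real q"
    using s by (simp_all add: divide_right_mono)
  have fr: "frac (x + shift \<beta> i + real k * \<alpha>) < 1 - c / real q" if "k < q" for i k
    using x that by (simp add: jump_free_def rotation_def add.assoc)
  have "x < 1 - c / real q"
    using fr[of 0 None] \<open>q > 0\<close> x01 by (simp add: shift_def frac_eq)
  then have rot: "rotation (s / real q) x = x + s / real q"
    using sq x01 by (intro rotation_eq_plus) auto
  have x': "rotation (s / real q) x \<in> {0..<1}" by simp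
  have psi: "psi (x + s / real q + shift \<beta> i + real k * \<alpha>) =
      psi (x + shift \<beta> i + real k * \<alpha>) + s / real q" if "k < q" for i k
  proof -
    let ?y = "x + shift \<beta> i + real k * \<alpha>"
    have "frac (?y + s / real q) = frac (frac ?y + s / real q)" by (simp only: frac_add_frac)
    also have "\<dots> = frac ?y + s / real q"
      unfolding frac_eq using fr[OF that, of i] sq frac_ge_0[of ?y] by linarith
    finally show ?thesis by (simp add: psi_def algebra_simps)
  qed
  show ?thesis
  proof (rule vec_eq_iff[THEN iffD2], rule allI)
    fix i
    show "cocycle_sum circle (rotation \<alpha>) (Psi \<beta>) (int q) (rotation (s / real q) x) $ i =
      (cocycle_sum circle (rotation \<alpha>) (Psi \<beta>) (int q) x + (\<chi> i. s)) $ i"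
      unfolding vector_add_component cocycle_sum_Psi_nth[OF x'] cocycle_sum_Psi_nth[OF x01]
      unfolding rot using \<open>q > 0\<close> by (simp add: psi sum.distrib)
  qed
qed

text \<open>The complement is a union of \<open>CARD('d option) * q\<close> rotated copies of an
  interval of length \<open>c / q\<close>, so the union bound does not depend on
  \<open>q\<close>.\<close>

lemma jump_free_measure:
  fixes \<beta> :: "'d::finite \<Rightarrow> real" and c :: real
  assumes "q > 0" "0 \<le> c" "c \<le> 1"
  shows "jump_free \<alpha> \<beta> q c \<in> sets circle"
    and "measure circle (jump_free \<alpha> \<beta> q c) \<ge> 1 - CARD('d option) * c"
proof -
  have cq: "0 \<le> c / real q" "c / real q \<le> 1" using assms by (simp_all add: divide_simps)
  let ?I = "{1 - c / real q..<1}"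
  have I: "?I \<in> sets circle" using cq by (simp add: sets_circle_iff)
  have mI: "measure circle ?I = c / real q"
    using cq by (simp add: measure_def emeasure_circle[OF I])
  let ?V = "\<lambda>(i, k). {x \<in> {0..<1}. rotation (shift \<beta> i + real k * \<alpha>) x \<in> ?I}"
  let ?J = "(UNIV :: 'd option set) \<times> {..<q}"
  have V: "?V z \<in> sets circle" for z
    using rotation_vimage_sets[OF I] by (cases z) simp
  have mV: "measure circle (?V z) = c / real q" for z
    using measure_rotation_vimage[OF I] by (cases z) (simp add: mI)
  have UV: "(\<Union>z\<in>?J. ?V z) \<in> sets circle" using V by (intro sets.finite_UN) auto
  have eq: "jump_free \<alpha> \<beta> q c = {0..<1} - (\<Union>z\<in>?J. ?V z)"
  proof (intro set_eqI iffI)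
    fix x assume "x \<in> jump_free \<alpha> \<beta> q c"
    then show "x \<in> {0..<1} - (\<Union>z\<in>?J. ?V z)"
      by (auto simp: jump_free_def not_le)
  next
    fix x assume x: "x \<in> {0..<1} - (\<Union>z\<in>?J. ?V z)"
    have "rotation (shift \<beta> i + real k * \<alpha>) x < 1 - c / real q" if "k < q" for i k
    proof -
      have "x \<notin> ?V (i, k)" using x that by blast
      then show ?thesis using x by auto
    qed
    then show "x \<in> jump_free \<alpha> \<beta> q c" using x by (simp add: jump_free_def)
  qed
  have sp: "{0..<1} \<in> sets circle" by (simp add: sets_circle_iff)
  show "jump_free \<alpha> \<beta> q c \<in> sets circle" unfolding eq using sp UV by (rule sets.Diff)
  have "measure circle (\<Union>z\<in>?J. ?V z) \<le> (\<Sum>z\<in>?J. measure circle (?V z))"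
    using V by (intro circle.finite_measure_subadditive_finite) auto
  also have "\<dots> = CARD('d option) * c"
    unfolding mV using assms by (simp add: card_cartesian_product del: card_option)
  finally have "measure circle (\<Union>z\<in>?J. ?V z) \<le> CARD('d option) * c" .
  moreover have "measure circle ({0..<1} - (\<Union>z\<in>?J. ?V z)) = 1 - measure circle (\<Union>z\<in>?J. ?V z)"
  proof -
    have "(\<Union>z\<in>?J. ?V z) \<subseteq> {0..<1}" by auto
    then show ?thesis
      by (simp only: circle.finite_measure_Diff[OF sp UV] measure_space_circle)
  qed
  ultimately show "measure circle (jump_free \<alpha> \<beta> q c) \<ge> 1 - CARD('d option) * c"
    unfolding eq by linarith
qed

section \<open>Compactness and a segment of essential values\<close>

text \<open>Otherwise each point of \<open>K\<close> has a neighbourhood whose visiting probability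
  tends to 0, and a finite subcover contradicts the lower bound \<open>c\<close>. Visits are counted
  within \<open>E n\<close> so that special properties of its points remain available.\<close>

lemma (in finite_measure) exists_frequently_visited_point:
  fixes f :: "nat \<Rightarrow> 'a \<Rightarrow> 'b::metric_space"
  assumes K: "compact K" and f: "\<And>n. f n \<in> borel_measurable M"
    and E: "\<And>n. E n \<in> sets M" "\<And>n. measure M (E n) \<ge> c" "c > 0"
    and EK: "\<And>n x. x \<in> E n \<Longrightarrow> f n x \<in> K"
  shows "\<exists>g\<in>K. \<forall>U. open U \<and> g \<in> U \<longrightarrow>
    (\<exists>\<eta>>0. \<exists>\<^sub>F n in sequentially. measure M {x \<in> E n. f n x \<in> U} \<ge> \<eta>)"
proof (rule ccontr)
  assume "\<not> ?thesis"
  then have "\<forall>g\<in>K. \<exists>U. open U \<and> g \<in> U \<and>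
      (\<forall>\<eta>>0. \<forall>\<^sub>F n in sequentially. measure M {x \<in> E n. f n x \<in> U} < \<eta>)"
    by (simp add: not_frequently not_le)
  from bchoice[OF this] obtain U where
    U': "\<forall>g\<in>K. open (U g) \<and> g \<in> U g \<and>
      (\<forall>\<eta>>0. \<forall>\<^sub>F n in sequentially. measure M {x \<in> E n. f n x \<in> U g} < \<eta>)"
    by (elim exE)
  then have U: "\<And>g. g \<in> K \<Longrightarrow> open (U g)" "\<And>g. g \<in> K \<Longrightarrow> g \<in> U g"
      "\<And>g \<eta>. g \<in> K \<Longrightarrow> \<eta> > 0 \<Longrightarrow>
        \<forall>\<^sub>F n in sequentially. measure M {x \<in> E n. f n x \<in> U g} < \<eta>"
    by simp_all
  obtain D where D: "D \<subseteq> K" "finite D" "K \<subseteq> (\<Union>g\<in>D. U g)"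
    using compactE_image[OF K, of K U] U by blast
  \<comment> \<open>The summand 1 makes \<open>card D * \<eta>\<close> strictly smaller than
    \<open>c\<close>, also when \<open>D\<close> is empty.\<close>
  define \<eta> where "\<eta> = c / (card D + 1)"
  have "\<eta> > 0" using \<open>c > 0\<close> by (simp add: \<eta>_def)
  then have "\<forall>\<^sub>F n in sequentially. \<forall>g\<in>D. measure M {x \<in> E n. f n x \<in> U g} < \<eta>"
    using D U(3) by (intro eventually_ball_finite) auto
  from eventually_happens'[OF sequentially_bot this]
  obtain n where n: "\<And>g. g \<in> D \<Longrightarrow> measure M {x \<in> E n. f n x \<in> U g} < \<eta>"
    by blast
  have S: "{x \<in> E n. f n x \<in> U g} \<in> sets M" if "g \<in> D" for g
  proof -
    have "{x \<in> E n. f n x \<in> U g} = E n \<inter> (f n -` U g \<inter> space M)"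
      using sets.sets_into_space[OF E(1)] by auto
    then show ?thesis
      using E(1) measurable_sets[OF f borel_open[OF U(1)]] D(1) that by auto
  qed
  have "c \<le> measure M (E n)" by (rule E)
  also have "\<dots> \<le> measure M (\<Union>g\<in>D. {x \<in> E n. f n x \<in> U g})"
  proof (rule finite_measure_mono)
    show "E n \<subseteq> (\<Union>g\<in>D. {x \<in> E n. f n x \<in> U g})" using EK D(3) by blast
    show "(\<Union>g\<in>D. {x \<in> E n. f n x \<in> U g}) \<in> sets M" using S D by (intro sets.finite_UN) auto
  qed
  also have "\<dots> \<le> (\<Sum>g\<in>D. measure M {x \<in> E n. f n x \<in> U g})"
    using S D by (intro finite_measure_subadditive_finite) auto
  also have "\<dots> \<le> card D * \<eta>"
    using n by (intro sum_bounded_above) (auto intro: less_imp_le)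
  also have "\<dots> < c" using \<open>c > 0\<close> by (simp add: \<eta>_def field_simps)
  finally show False by simp
qed

text \<open>Compactness gives one \<open>g\<close> visited often from jump-free points. Moving such
  points by \<open>s / q\<close> turns visits near \<open>g\<close> into visits near
  \<open>g\<close> plus the diagonal vector of \<open>s\<close>, without loss of measure, so the
  rigid-times criterion applies to every \<open>s\<close> in \<open>[0, c]\<close>.\<close>

lemma essential_segment:
  fixes \<beta> :: "'d::finite \<Rightarrow> real"
  assumes \<alpha>: "\<alpha> \<notin> \<rat>"
  shows "\<exists>g. \<exists>c>0. \<forall>s. 0 \<le> s \<and> s \<le> c \<longrightarrow>
    essential_value circle (rotation \<alpha>) (Psi \<beta>) (g + (\<chi> i. s))"
proof -
  \<comment> \<open>Dirichlet approximation: an irrational number has coprime approximations with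
    error below \<open>1 / q^2\<close> and arbitrarily large denominators \<open>q\<close>.\<close>
  have "\<exists>z. z \<in> approx_set \<alpha> \<and> snd z > int n" for n
    using infinite_approx_set[of \<alpha> "int n"] \<alpha> rational_iff_finite_approx_set[of \<alpha>] by auto
  then obtain z where z: "\<And>n. z n \<in> approx_set \<alpha>" "\<And>n. snd (z n) > int n" by metis
  define P where "P n = fst (z n)" for n
  define q where "q n = nat (snd (z n))" for n
  have qi: "int (q n) = snd (z n)" for n using z(2)[of n] by (simp add: q_def)
  have q: "q n > n" for n using z(2)[of n] qi[of n] by simp
  have q0: "q n > 0" for n using q[of n] by simp
  have rq: "real_of_int (snd (z n)) = real (q n)" for n using qi[of n] by (metis of_int_of_nat_eq)
  have cop: "coprime (P n) (int (q n))"
    and app: "\<bar>\<alpha> - of_int (P n) / real (q n)\<bar> < 1 / (real (q n))\<^sup>2" for n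
    using z(1)[of n] unfolding approx_set_def P_def rq[symmetric] qi by auto
  have bound: "\<bar>of_int (int (q n)) * \<alpha> - of_int (P n)\<bar> \<le> 1 / real (Suc n)" for n
  proof -
    have r: "real (q n) > 0" using q0[of n] by simp
    have "\<bar>of_int (int (q n)) * \<alpha> - of_int (P n)\<bar> = real (q n) * \<bar>\<alpha> - of_int (P n) / real (q n)\<bar>"
    proof -
      have "of_int (int (q n)) * \<alpha> - of_int (P n) = real (q n) * (\<alpha> - of_int (P n) / real (q n))"
        using r by (simp add: field_simps)
      then show ?thesis by (simp add: abs_mult)
    qed
    also have "\<dots> \<le> real (q n) * (1 / (real (q n))\<^sup>2)"
      using app[of n] r by (intro mult_left_mono) auto
    also have "\<dots> = 1 / real (q n)" using r by (simp add: power2_eq_square)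
    also have "\<dots> \<le> 1 / real (Suc n)" using q[of n] by (intro divide_left_mono) auto
    finally show ?thesis .
  qed
  have rigid: "(\<lambda>n. of_int (int (q n)) * \<alpha> - of_int (P n)) \<longlonglongrightarrow> 0"
    by (rule Lim_null_comparison[OF _ lim_inverse_n'[THEN LIMSEQ_Suc]]) (use bound in auto)
  let ?S = "\<lambda>n. cocycle_sum circle (rotation \<alpha>) (Psi \<beta>) (int (q n))"
  have S: "?S n \<in> borel_measurable circle" for n
    by (intro cocycle_sum_measurable Psi_measurable)
  \<comment> \<open>One cube serves for all \<open>n\<close>: here the bound on the sawtooth sums,
    uniform in \<open>q\<close>, supplies compactness.\<close>
  define K :: "(real ^ 'd option) set" where "K = cbox (\<chi> i. -5) (\<chi> i. 5)"
  have SK: "?S n x \<in> K" if "x \<in> {0..<1}" for n x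
    unfolding K_def mem_box_cart
  proof
    fix i
    have "\<bar>?S n x $ i\<bar> \<le> 5"
      using abs_sum_psi_le[OF cop q0 app] by (simp only: cocycle_sum_Psi_nth[OF that])
    then show "(\<chi> i. -5) $ i \<le> ?S n x $ i \<and> ?S n x $ i \<le> (\<chi> i. 5) $ i"
      by (simp add: abs_le_iff)
  qed
  \<comment> \<open>Chosen so that the jump-free sets keep measure at least 1/2.\<close>
  define c :: real where "c = 1 / (2 * CARD('d option))"
  have c: "0 < c" "c \<le> 1" "CARD('d option) * c = 1 / 2" by (simp_all add: c_def)
  define E where "E n = jump_free \<alpha> \<beta> (q n) c" for n
  have E: "E n \<in> sets circle" "measure circle (E n) \<ge> 1 / 2" for n
    using jump_free_measure[OF q0, where c = c and \<alpha> = \<alpha> and \<beta> = \<beta>] c by (simp_all add: E_def del: card_option)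
  have "\<exists>g\<in>K. \<forall>U. open U \<and> g \<in> U \<longrightarrow>
    (\<exists>\<eta>>0. \<exists>\<^sub>F n in sequentially. measure circle {x \<in> E n. ?S n x \<in> U} \<ge> \<eta>)"
    by (rule circle.exists_frequently_visited_point[OF _ S E])
      (use SK in \<open>auto simp: K_def E_def jump_free_def\<close>)
  then obtain g where g: "\<And>U. open U \<Longrightarrow> g \<in> U \<Longrightarrow>
    (\<exists>\<eta>>0. \<exists>\<^sub>F n in sequentially. measure circle {x \<in> E n. ?S n x \<in> U} \<ge> \<eta>)" by blast
  have "essential_value circle (rotation \<alpha>) (Psi \<beta>) (g + (\<chi> i. s))" if s: "0 \<le> s" "s \<le> c" for s
  proof (rule essential_value_of_rigid_times[OF \<alpha> Psi_measurable rigid])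
    fix U :: "(real ^ 'd option) set" assume U: "open U" "g + (\<chi> i. s) \<in> U"
    let ?U = "(\<lambda>y. y + (\<chi> i. s)) -` U"
    have "open ?U" by (intro open_vimage U continuous_intros)
    then obtain \<eta> where \<eta>: "\<eta> > 0"
      "\<exists>\<^sub>F n in sequentially. measure circle {x \<in> E n. ?S n x \<in> ?U} \<ge> \<eta>"
      using g[of ?U] U(2) by auto
    have le: "measure circle {x \<in> E n. ?S n x \<in> ?U} \<le> measure circle {x \<in> {0..<1}. ?S n x \<in> U}" for n
    proof -
      let ?W = "{x \<in> {0..<1}. ?S n x \<in> U}"
      have "?W = ?S n -` U \<inter> space circle" by auto
      then have W: "?W \<in> sets circle" using measurable_sets[OF S borel_open[OF U(1)]] by simp
      have "{x \<in> E n. ?S n x \<in> ?U} \<subseteq> {x \<in> {0..<1}. rotation (s / real (q n)) x \<in> ?W}"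
      proof (intro subsetI CollectI conjI)
        fix x assume "x \<in> {x \<in> E n. ?S n x \<in> ?U}"
        then have x: "x \<in> jump_free \<alpha> \<beta> (q n) c" "?S n x + (\<chi> i. s) \<in> U"
          by (auto simp: E_def)
        then show "x \<in> {0..<1}" by (simp add: jump_free_def)
        show "?S n (rotation (s / real (q n)) x) \<in> U"
          using x jump_free_translate[OF x(1) s q0] by simp
      qed simp
      then have "measure circle {x \<in> E n. ?S n x \<in> ?U} \<le>
          measure circle {x \<in> {0..<1}. rotation (s / real (q n)) x \<in> ?W}"
        by (intro circle.finite_measure_mono rotation_vimage_sets W)
      then show ?thesis by (simp only: measure_rotation_vimage[OF W])
    qed
    have "\<exists>\<^sub>F n in sequentially. measure circle {x \<in> {0..<1}. ?S n x \<in> U} \<ge> \<eta>"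
      by (rule frequently_mono[OF _ \<eta>(2)]) (use le order_trans in blast)
    then show "\<exists>\<eta>>0. \<exists>\<^sub>F n in sequentially. measure circle {x \<in> {0..<1}. ?S n x \<in> U} \<ge> \<eta>"
      using \<eta>(1) by blast
  qed
  then show ?thesis using c(1) by blast
qed

section \<open>From the segment to the whole diagonal\<close>

theorem proposition4p1:
  fixes \<alpha> :: real and \<beta> :: "'d::finite \<Rightarrow> real"
  assumes "0 < \<alpha>" and "\<alpha> < 1" and "\<alpha> \<notin> \<rat>"
    and "\<And>j. 0 \<le> \<beta> j \<and> \<beta> j < 1"
  shows "diagonal_subgroup \<subseteq> essential_values circle (rotation \<alpha>) (Psi \<beta>)"
proof -
  define ev where "ev t = essential_value circle (rotation \<alpha>) (Psi \<beta>) (\<chi> i. t)" for t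
  obtain g c where c: "c > 0" and g: "\<And>s. 0 \<le> s \<Longrightarrow> s \<le> c \<Longrightarrow>
      essential_value circle (rotation \<alpha>) (Psi \<beta>) (g + (\<chi> i. s))"
    using essential_segment[OF assms(3), of \<beta>] by blast
  have diff: "ev (s - t)" if "ev s" "ev t" for s t
  proof -
    have "(\<chi> i. s) - (\<chi> i. t) = ((\<chi> i. s - t) :: real ^ 'd option)" by (simp add: vec_eq_iff)
    then show ?thesis using essential_value_diff[OF Psi_measurable] that by (metis ev_def)
  qed
  \<comment> \<open>Subtracting the endpoint \<open>s = 0\<close> of the segment removes the unknown
    \<open>g\<close>.\<close>
  have small: "ev t" if "0 \<le> t" "t \<le> c" for t
    using essential_value_diff[OF Psi_measurable g[OF that] g[of 0]] c
    by (simp add: ev_def add_diff_add flip: zero_vec_def)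
  \<comment> \<open>Only differences are available, so the sum is written as
    \<open>s - (0 - t)\<close>.\<close>
  have add: "ev (s + t)" if "ev s" "ev t" for s t
    using diff[OF that(1) diff[OF small[of 0] that(2)]] c by simp
  have "ev t" if "t \<ge> 0" for t
  proof -
    \<comment> \<open>\<open>t\<close> is cut into \<open>n\<close> equal steps, each shorter than
      \<open>c\<close>, which are added up one by one.\<close>
    obtain n where n: "t / c < real n" using reals_Archimedean2 by blast
    have "n > 0" using n that c by (cases n) (auto simp: divide_less_0_iff)
    have "ev (real k * (t / n))" for k
    proof (induction k)
      case (Suc k)
      have "t / n \<le> c" using n c \<open>n > 0\<close> by (simp add: field_simps)
      then have "ev (real k * (t / n) + t / n)" using add[OF Suc small] that by simp
      moreover have "real k * (t / n) + t / n = real (Suc k) * (t / n)"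
        by (simp add: add_divide_distrib ring_distribs)
      ultimately show ?case by (simp only:)
    qed (use small c in simp)
    from this[of n] show ?thesis using \<open>n > 0\<close> by simp
  qed
  then have "ev t" for t
    using diff[of 0 "- t"] by (cases "t \<ge> 0") (auto simp: not_le)
  then show ?thesis
    by (auto simp: diagonal_subgroup_def essential_values_def ev_def)
qed

end
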